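(* Let $(X,c)$ be a closure space with interior operator $i$. (1) If $\{A,B\}$ is an interior cover of $X$, then for all $n\in\mathbb{Z}$ there is an isomorphism $H_n(X,A)\cong H_n(B,A\cap B)$. (2) Equivalently: given subsets $Z\subset A\subset X$ such that $c(Z)\subset i(A)$, the inclusion $(X\setminus Z,A\setminus Z)\to (X,A)$ induces isomorphisms $H_n(X\setminus Z,A\setminus Z)\cong H_n(X,A)$ for all $n$.
   Context: A (Čech) closure space is a pair $(X,c)$ of a set $X$ and a function $c:2^X\to 2^X$ with $c(\varnothing)=\varnothing$, $A\subset c(A)$, and $c(A\cup B)=c(A)\cup c(B)$ for all $A,B\subset X$. Topological spaces are the closure spaces with $c(c(A))=c(A)$ for all $A$, where $c$ is the topological closure. A map $f:(X,c)\to(Y,d)$ is continuous if $f(c(A))\subset d(f(A))$ for all $A\subset X$. A subset $A\subset X$ carries the subspace closure $c_A(B)=A\cap c(B)$ for $B\subset A$. The interior operator is $i(A)=X\setminus c(X\setminus A)$. A family $\mathcal{U}$ of subsets is an interior cover of $X$ if $X=\bigcup_{U\in\mathcal{U}} i(U)$. Singular homology: let $|\Delta^n|=\{(t_0,\dots,t_n)\in\mathbb{R}^{n+1} : \sum_i t_i=1,\ t_i\ge 0\}=[e_0,\dots,e_n]$ with the Euclidean topology. $C_n(X)$ is the free abelian group on continuous maps $\sigma:|\Delta^n|\to X$ (and $C_n(X)=0$ for $n<0$), with $\partial_n(\sigma)=\sum_{i=0}^n(-1)^i\sigma|_{[e_0,\dots,\hat e_i,\dots,e_n]}$. For a subspace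 $A\subset X$, $C_n(X,A)=C_n(X)/C_n(A)$ with the induced boundary, and $H_n(X,A)$ is the homology of this quotient complex. *)

theory Defs
  imports "HOL-Homology.Homology"
begin

section \<open>Closure spaces\<close>

text \<open>The operator \<^term>\<open>c\<close> is only constrained, and only ever used, on subsets of \<^term>\<open>X\<close>.\<close>

locale closure_space =
  fixes X :: "'a set" and c :: "'a set \<Rightarrow> 'a set"
  assumes closure_subset_carrier: "A \<subseteq> X \<Longrightarrow> c A \<subseteq> X"
    and closure_empty: "c {} = {}"
    and closure_extensive: "A \<subseteq> X \<Longrightarrow> A \<subseteq> c A"
    and closure_union: "\<lbrakk>A \<subseteq> X; B \<subseteq> X\<rbrakk> \<Longrightarrow> c (A \<union> B) = c A \<union> c B"

definition closure_continuous ::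
    "'a set \<Rightarrow> ('a set \<Rightarrow> 'a set) \<Rightarrow> 'b set \<Rightarrow> ('b set \<Rightarrow> 'b set) \<Rightarrow> ('a \<Rightarrow> 'b) \<Rightarrow> bool"
  where "closure_continuous X c Y d f \<longleftrightarrow> f \<in> X \<rightarrow> Y \<and> (\<forall>A\<subseteq>X. f ` c A \<subseteq> d (f ` A))"

definition subspace_closure :: "('a set \<Rightarrow> 'a set) \<Rightarrow> 'a set \<Rightarrow> 'a set \<Rightarrow> 'a set"
  where "subspace_closure c A B = A \<inter> c B"

definition closure_interior :: "'a set \<Rightarrow> ('a set \<Rightarrow> 'a set) \<Rightarrow> 'a set \<Rightarrow> 'a set"
  where "closure_interior X c A = X - c (X - A)"

definition interior_cover :: "'a set \<Rightarrow> ('a set \<Rightarrow> 'a set) \<Rightarrow> 'a set set \<Rightarrow> bool"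
  where "interior_cover X c \<U> \<longleftrightarrow>
    (\<forall>U\<in>\<U>. U \<subseteq> X) \<and> X = (\<Union>U\<in>\<U>. closure_interior X c U)"

lemma closure_space_closure_of: "closure_space (topspace T) ((closure_of) T)"
  by unfold_locales (auto simp: closure_of_subset_topspace closure_of_subset closure_of_Un)

lemma closure_space_subspace:
  assumes "closure_space X c" "A \<subseteq> X"
  shows "closure_space A (subspace_closure c A)"
proof -
  interpret closure_space X c by fact
  show ?thesis
  proof
    fix B D assume "B \<subseteq> A" "D \<subseteq> A"
    then have *: "B \<subseteq> X" "D \<subseteq> X" using assms(2) by auto
    show "subspace_closure c A (B \<union> D) = subspace_closure c A B \<union> subspace_closure c A D"
      using closure_union[OF *] by (auto simp: subspace_closure_def)
  next
    fix B assume "B \<subseteq> A"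
    then show "B \<subseteq> subspace_closure c A B"
      using closure_extensive[of B] assms(2) by (auto simp: subspace_closure_def)
  qed (auto simp: subspace_closure_def closure_empty)
qed

section \<open>Maps between quotient groups\<close>

text \<open>The map from \<^term>\<open>G Mod N\<close> to \<^term>\<open>H Mod M\<close> induced by \<^term>\<open>h\<close>; see \<open>coset_map_coset\<close>
  for its value on a coset.\<close>

definition coset_map :: "('b, 'n) monoid_scheme \<Rightarrow> 'b set \<Rightarrow> ('a \<Rightarrow> 'b) \<Rightarrow> 'a set \<Rightarrow> 'b set"
  where "coset_map H M h K = the_elem ((\<lambda>x. M #>\<^bsub>H\<^esub> h x) ` K)"

lemma coset_map_coset:
  assumes h: "h \<in> hom G H" and N: "N \<lhd> G" and M: "M \<lhd> H" and "h ` N \<subseteq> M"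
    and x: "x \<in> carrier G"
  shows "coset_map H M h (N #>\<^bsub>G\<^esub> x) = M #>\<^bsub>H\<^esub> h x"
proof -
  interpret N: normal N G by fact
  interpret M: normal M H by fact
  have "M #>\<^bsub>H\<^esub> h y = M #>\<^bsub>H\<^esub> h x" if "y \<in> N #>\<^bsub>G\<^esub> x" for y
  proof -
    obtain k where k: "k \<in> N" "y = k \<otimes>\<^bsub>G\<^esub> x" using \<open>y \<in> N #>\<^bsub>G\<^esub> x\<close> by (auto simp: r_coset_def)
    have kG: "k \<in> carrier G" using k N.subset by auto
    have "h y = h k \<otimes>\<^bsub>H\<^esub> h x" using k kG x h by (simp add: hom_mult)
    moreover have "h k \<in> M" using assms(4) k by auto
    ultimately have "h y \<in> M #>\<^bsub>H\<^esub> h x" by (auto simp: r_coset_def)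
    then show ?thesis
      using M.repr_independence[of "h y" M "h x"] hom_in_carrier[OF h x] M.is_subgroup by simp
  qed
  moreover have "x \<in> N #>\<^bsub>G\<^esub> x" using N.rcos_self x N.is_subgroup by auto
  ultimately have "(\<lambda>y. M #>\<^bsub>H\<^esub> h y) ` (N #>\<^bsub>G\<^esub> x) = {M #>\<^bsub>H\<^esub> h x}" by blast
  then show ?thesis by (simp add: coset_map_def)
qed

lemma coset_map_hom:
  assumes h: "h \<in> hom G H" and N: "N \<lhd> G" and M: "M \<lhd> H" and hN: "h ` N \<subseteq> M"
  shows "coset_map H M h \<in> hom (G Mod N) (H Mod M)"
proof (rule homI)
  interpret N: normal N G by fact
  interpret M: normal M H by fact
  note cm = coset_map_coset[OF h N M hN]
  fix K assume "K \<in> carrier (G Mod N)"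
  then obtain x where x: "x \<in> carrier G" "K = N #>\<^bsub>G\<^esub> x" by (auto simp: carrier_FactGroup)
  then show "coset_map H M h K \<in> carrier (H Mod M)"
    using hom_in_carrier[OF h] by (auto simp: cm carrier_FactGroup)
  fix L assume "L \<in> carrier (G Mod N)"
  then obtain y where y: "y \<in> carrier G" "L = N #>\<^bsub>G\<^esub> y" by (auto simp: carrier_FactGroup)
  show "coset_map H M h (K \<otimes>\<^bsub>G Mod N\<^esub> L) = coset_map H M h K \<otimes>\<^bsub>H Mod M\<^esub> coset_map H M h L"
    using x y hom_in_carrier[OF h] h
    by (simp add: cm N.rcos_sum M.rcos_sum hom_mult)
qed

section \<open>Singular homology of closure spaces\<close>

text \<open>As in \<open>HOL-Homology\<close>, \<^term>\<open>standard_simplex p\<close> sits in the sequences vanishing beyond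
  index \<^term>\<open>p\<close>, where the product topology is the Euclidean topology of dimension \<^term>\<open>p + 1\<close>.
  Simplices are made extensional so that they are determined by their values on the standard
  simplex; a simplex of a subspace is then literally a simplex of the whole space.\<close>

definition closure_simplex ::
    "nat \<Rightarrow> 'a set \<Rightarrow> ('a set \<Rightarrow> 'a set) \<Rightarrow> ((nat \<Rightarrow> real) \<Rightarrow> 'a) \<Rightarrow> bool"
  where "closure_simplex p X c \<sigma> \<longleftrightarrow>
    closure_continuous (standard_simplex p)
      ((closure_of) (subtopology (powertop_real UNIV) (standard_simplex p))) X c \<sigma> \<and>
    \<sigma> \<in> extensional (standard_simplex p)"

lemma closure_simplex_topological:
  "closure_simplex p (topspace T) ((closure_of) T) \<sigma> \<longleftrightarrow> singular_simplex p T \<sigma>"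
proof -
  let ?D = "subtopology (powertop_real UNIV) (standard_simplex p)"
  have "continuous_map ?D T \<sigma> \<longleftrightarrow>
      \<sigma> \<in> topspace ?D \<rightarrow> topspace T \<and> (\<forall>S\<subseteq>topspace ?D. \<sigma> ` (?D closure_of S) \<subseteq> T closure_of \<sigma> ` S)"
    unfolding image_subset_iff_funcset
    using continuous_map_eq_image_closure_subset_alt[of ?D T \<sigma>] continuous_map_funspace[of ?D T \<sigma>]
    by blast
  then show ?thesis
    unfolding closure_simplex_def closure_continuous_def singular_simplex_def
    by (simp only: topspace_standard_simplex)
qed

definition closure_chain_group :: "int \<Rightarrow> 'a set \<Rightarrow> ('a set \<Rightarrow> 'a set) \<Rightarrow> 'a chain monoid"
  where "closure_chain_group n X c =
    free_Abelian_group (if n < 0 then {} else {\<sigma>. closure_simplex (nat n) X c \<sigma>})"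

abbreviation subspace_chains :: "int \<Rightarrow> ('a set \<Rightarrow> 'a set) \<Rightarrow> 'a set \<Rightarrow> 'a chain set"
  where "subspace_chains n c A \<equiv> carrier (closure_chain_group n A (subspace_closure c A))"

definition rel_chain_group ::
    "int \<Rightarrow> 'a set \<Rightarrow> ('a set \<Rightarrow> 'a set) \<Rightarrow> 'a set \<Rightarrow> 'a chain set monoid"
  where "rel_chain_group n X c A = closure_chain_group n X c Mod subspace_chains n c A"

text \<open>The boundary of singular chains is \<^term>\<open>chain_boundary\<close> from \<open>HOL-Homology\<close>, which does not
  refer to a topology.  It vanishes in degree 0, hence also at \<^term>\<open>nat n\<close> for negative
  \<^term>\<open>n\<close>.\<close>

definition rel_chain_boundary ::
    "int \<Rightarrow> 'a set \<Rightarrow> ('a set \<Rightarrow> 'a set) \<Rightarrow> 'a set \<Rightarrow> 'a chain set \<Rightarrow> 'a chain set"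
  where "rel_chain_boundary n X c A =
    coset_map (closure_chain_group (n - 1) X c) (subspace_chains (n - 1) c A)
      (chain_boundary (nat n))"

definition rel_cycle_group ::
    "int \<Rightarrow> 'a set \<Rightarrow> ('a set \<Rightarrow> 'a set) \<Rightarrow> 'a set \<Rightarrow> 'a chain set monoid"
  where "rel_cycle_group n X c A =
    (rel_chain_group n X c A)\<lparr>carrier :=
      kernel (rel_chain_group n X c A) (rel_chain_group (n - 1) X c A)
        (rel_chain_boundary n X c A)\<rparr>"

definition rel_boundaries ::
    "int \<Rightarrow> 'a set \<Rightarrow> ('a set \<Rightarrow> 'a set) \<Rightarrow> 'a set \<Rightarrow> 'a chain set set"
  where "rel_boundaries n X c A =
    rel_chain_boundary (n + 1) X c A ` carrier (rel_chain_group (n + 1) X c A)"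

definition rel_homology ::
    "int \<Rightarrow> 'a set \<Rightarrow> ('a set \<Rightarrow> 'a set) \<Rightarrow> 'a set \<Rightarrow> 'a chain set set monoid"
  where "rel_homology n X c A = rel_cycle_group n X c A Mod rel_boundaries n X c A"

subsection \<open>The relative chains form a chain complex\<close>

lemma closure_chain_group_simps [simp]:
  "monoid.mult (closure_chain_group n X c) = (+)"
  "one (closure_chain_group n X c) = 0"
  by (simp_all add: closure_chain_group_def free_Abelian_group_def)

lemma mem_closure_chain_group:
  "a \<in> carrier (closure_chain_group n X c) \<longleftrightarrow>
    (\<forall>\<sigma>\<in>Poly_Mapping.keys a. 0 \<le> n \<and> closure_simplex (nat n) X c \<sigma>)"
  by (auto simp: closure_chain_group_def free_Abelian_group_def)

lemma comm_group_closure_chain_group: "comm_group (closure_chain_group n X c)"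
  unfolding closure_chain_group_def by (rule abelian_free_Abelian_group)

lemma group_closure_chain_group: "group (closure_chain_group n X c)"
  using comm_group_closure_chain_group comm_group.axioms(2) by blast

lemma closure_simplex_face:
  assumes \<sigma>: "closure_simplex p X c \<sigma>" and "1 \<le> p" "k \<le> p"
  shows "closure_simplex (p - Suc 0) X c (singular_face p k \<sigma>)"
proof -
  let ?T = "\<lambda>p. subtopology (powertop_real UNIV) (standard_simplex p)"
  let ?F = "restrict (simplical_face k) (standard_simplex (p - Suc 0))"
  have "singular_simplex p (?T p) (restrict (\<lambda>x. x) (standard_simplex p))"
    by (auto simp: singular_simplex_def
        intro: continuous_map_eq[OF continuous_map_id[unfolded id_def]])
  from singular_simplex_singular_face[OF this assms(2,3)]
  have "continuous_map (?T (p - Suc 0)) (?T p)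
      (singular_face p k (restrict (\<lambda>x. x) (standard_simplex p)))"
    by (simp add: singular_simplex_def)
  moreover have "singular_face p k (restrict (\<lambda>x. x) (standard_simplex p)) = ?F"
    using assms(2,3) by (auto simp: singular_face_def simplical_face_in_standard_simplex)
  ultimately have F: "continuous_map (?T (p - Suc 0)) (?T p) ?F" by simp
  have eq: "singular_face p k \<sigma> x = \<sigma> (?F x)" if "x \<in> standard_simplex (p - Suc 0)" for x
    using that by (simp add: singular_face_def)
  have FS: "?F x \<in> standard_simplex p" if "x \<in> standard_simplex (p - Suc 0)" for x
    using that assms(2,3) by (simp add: simplical_face_in_standard_simplex)
  have "singular_face p k \<sigma> ` (?T (p - Suc 0) closure_of S) \<subseteq> c (singular_face p k \<sigma> ` S)"
    if S: "S \<subseteq> standard_simplex (p - Suc 0)" for S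
  proof -
    have sub: "?T (p - Suc 0) closure_of S \<subseteq> standard_simplex (p - Suc 0)"
      using closure_of_subset_topspace[of "?T (p - Suc 0)" S] by simp
    have "singular_face p k \<sigma> ` (?T (p - Suc 0) closure_of S)
        = \<sigma> ` ?F ` (?T (p - Suc 0) closure_of S)"
      unfolding image_image using sub eq by (intro image_cong) blast+
    also have "\<dots> \<subseteq> \<sigma> ` (?T p closure_of (?F ` S))"
      by (intro image_mono continuous_map_image_closure_subset[OF F])
    also have "\<dots> \<subseteq> c (\<sigma> ` ?F ` S)"
    proof -
      have "?F ` S \<subseteq> standard_simplex p" using S FS by auto
      then show ?thesis using \<sigma> unfolding closure_simplex_def closure_continuous_def by blast
    qed
    also have "\<sigma> ` ?F ` S = singular_face p k \<sigma> ` S"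
      unfolding image_image using S eq by (intro image_cong) (simp_all add: subset_iff)
    finally show ?thesis .
  qed
  moreover have "singular_face p k \<sigma> x \<in> X" if "x \<in> standard_simplex (p - Suc 0)" for x
  proof -
    have "\<sigma> (?F x) \<in> X"
      using \<sigma> FS[OF that] unfolding closure_simplex_def closure_continuous_def by blast
    then show ?thesis using eq[OF that] by simp
  qed
  ultimately show ?thesis
    unfolding closure_simplex_def closure_continuous_def by (auto simp: singular_face_def)
qed

lemma closure_simplex_subspace:
  assumes "closure_simplex p A (subspace_closure c A) \<sigma>" "A \<subseteq> X"
  shows "closure_simplex p X c \<sigma>"
  using assms unfolding closure_simplex_def closure_continuous_def subspace_closure_def by blast

lemma chain_boundary_hom:
  "chain_boundary (nat n) \<in> hom (closure_chain_group n X c) (closure_chain_group (n - 1) X c)"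
proof (rule homI)
  fix a assume a: "a \<in> carrier (closure_chain_group n X c)"
  show "chain_boundary (nat n) a \<in> carrier (closure_chain_group (n - 1) X c)"
  proof (cases "n \<le> 0")
    case True
    then show ?thesis by (simp add: chain_boundary_def mem_closure_chain_group)
  next
    case False
    interpret group "closure_chain_group (n - 1) X c" by (rule group_closure_chain_group)
    let ?C = "carrier (closure_chain_group (n - 1) X c)"
    have plus: "x + y \<in> ?C" if "x \<in> ?C" "y \<in> ?C" for x y
      using m_closed[OF that] by simp
    have zero: "0 \<in> ?C" using one_closed by simp
    have sumC: "sum f I \<in> ?C" if "\<And>i. i \<in> I \<Longrightarrow> f i \<in> ?C" for f :: "'b \<Rightarrow> _" and I
      using that by (induction I rule: infinite_finite_induct) (auto simp: plus zero)
    have cmul: "frag_cmul k x \<in> ?C" if "x \<in> ?C" for x k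
      using that keys_cmul[of k x] by (auto simp: mem_closure_chain_group)
    have sumC': "sum f I \<in> ?C" if "\<And>i. i \<in> I \<Longrightarrow> f i \<in> ?C" for f :: "nat \<Rightarrow> _" and I
      using that by (induction I rule: infinite_finite_induct) (auto simp: plus zero)
    have face: "frag_of (singular_face (nat n) k \<sigma>) \<in> ?C"
      if "\<sigma> \<in> Poly_Mapping.keys a" "k \<le> nat n" for k \<sigma>
      using closure_simplex_face[of "nat n" X c \<sigma> k] a that False
      by (auto simp: mem_closure_chain_group nat_diff_distrib)
    show ?thesis
      using False by (auto simp: chain_boundary_def frag_extend_def intro!: sumC sumC' cmul face)
  qed
qed (simp add: chain_boundary_add)

lemma subspace_chains_normal:
  assumes "A \<subseteq> X"
  shows "subspace_chains n c A \<lhd> closure_chain_group n X c"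
proof -
  interpret A: group "closure_chain_group n A (subspace_closure c A)"
    by (rule group_closure_chain_group)
  interpret X: comm_group "closure_chain_group n X c" by (rule comm_group_closure_chain_group)
  have sub: "subspace_chains n c A \<subseteq> carrier (closure_chain_group n X c)"
    using closure_simplex_subspace[OF _ assms] by (auto simp: mem_closure_chain_group)
  have "subgroup (subspace_chains n c A) (closure_chain_group n X c)"
  proof (rule X.subgroupI[OF sub])
    show "subspace_chains n c A \<noteq> {}" using A.one_closed by auto
    fix a assume a: "a \<in> subspace_chains n c A"
    then have "a \<in> carrier (closure_chain_group n X c)" using sub by blast
    then have "Poly_Mapping.keys a \<subseteq> (if n < 0 then {} else {\<sigma>. closure_simplex (nat n) X c \<sigma>})"
      by (auto simp: closure_chain_group_def free_Abelian_group_def)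
    then have "inv\<^bsub>closure_chain_group n X c\<^esub> a = - a"
      unfolding closure_chain_group_def by (rule inv_free_Abelian_group)
    then show "inv\<^bsub>closure_chain_group n X c\<^esub> a \<in> subspace_chains n c A"
      using a by (simp add: mem_closure_chain_group)
    fix b assume "b \<in> subspace_chains n c A"
    with a show "a \<otimes>\<^bsub>closure_chain_group n X c\<^esub> b \<in> subspace_chains n c A"
      using A.m_closed by simp
  qed
  then show ?thesis by (simp add: X.normal_iff_subgroup)
qed

lemma rel_chain_boundary_coset:
  assumes "A \<subseteq> X" "a \<in> carrier (closure_chain_group n X c)"
  shows "rel_chain_boundary n X c A (subspace_chains n c A #>\<^bsub>closure_chain_group n X c\<^esub> a) =
    subspace_chains (n - 1) c A #>\<^bsub>closure_chain_group (n - 1) X c\<^esub> chain_boundary (nat n) a"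
  unfolding rel_chain_boundary_def
  by (intro coset_map_coset[OF chain_boundary_hom] subspace_chains_normal assms
      hom_carrier[OF chain_boundary_hom])

lemma rel_chain_boundary_hom:
  assumes "A \<subseteq> X"
  shows "rel_chain_boundary n X c A \<in> hom (rel_chain_group n X c A) (rel_chain_group (n - 1) X c A)"
  unfolding rel_chain_boundary_def rel_chain_group_def
  by (intro coset_map_hom[OF chain_boundary_hom] subspace_chains_normal assms
      hom_carrier[OF chain_boundary_hom])

lemma comm_group_rel_chain_group:
  assumes "A \<subseteq> X"
  shows "comm_group (rel_chain_group n X c A)"
  unfolding rel_chain_group_def
  using comm_group.abelian_FactGroup[OF comm_group_closure_chain_group]
    normal_imp_subgroup[OF subspace_chains_normal[OF assms]] by blast

lemma rel_chain_boundary_boundary: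
  assumes "A \<subseteq> X" and K: "K \<in> carrier (rel_chain_group (n + 1) X c A)"
  shows "rel_chain_boundary n X c A (rel_chain_boundary (n + 1) X c A K) =
    \<one>\<^bsub>rel_chain_group (n - 1) X c A\<^esub>"
proof -
  obtain a where a: "a \<in> carrier (closure_chain_group (n + 1) X c)"
    and Ka: "K = subspace_chains (n + 1) c A #>\<^bsub>closure_chain_group (n + 1) X c\<^esub> a"
    using K by (auto simp: rel_chain_group_def carrier_FactGroup)
  have b: "chain_boundary (nat (n + 1)) a \<in> carrier (closure_chain_group n X c)"
    using hom_in_carrier[OF chain_boundary_hom a] by simp
  have zero: "chain_boundary (nat n) (chain_boundary (nat (n + 1)) a) = 0"
  proof (cases "0 \<le> n")
    case True
    txt \<open>Every extensional map is continuous into the indiscrete topology.\<close>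
    have "singular_simplex (nat (n + 1)) (topology (\<lambda>S. S = {} \<or> S = UNIV)) \<sigma>"
      if "\<sigma> \<in> Poly_Mapping.keys a" for \<sigma>
    proof -
      have "istopology (\<lambda>S. S = {} \<or> S = (UNIV :: 'a set))"
        unfolding istopology_def by blast
      then have op: "openin (topology (\<lambda>S. S = {} \<or> S = (UNIV :: 'a set))) = (\<lambda>S. S = {} \<or> S = UNIV)"
        by (rule topology_inverse')
      then have "topspace (topology (\<lambda>S. S = {} \<or> S = (UNIV :: 'a set))) = UNIV"
        unfolding topspace_def by auto
      then have "continuous_map T (topology (\<lambda>S. S = {} \<or> S = (UNIV :: 'a set))) \<sigma>" for T
        by (auto simp: continuous_map_def op)
      moreover have "\<sigma> \<in> extensional (standard_simplex (nat (n + 1)))"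
        using a that by (auto simp: mem_closure_chain_group closure_simplex_def)
      ultimately show ?thesis by (simp add: singular_simplex_def)
    qed
    then have "singular_chain (nat (n + 1)) (topology (\<lambda>S. S = {} \<or> S = UNIV)) a"
      by (auto simp: singular_chain_def)
    from chain_boundary_boundary[OF this] True show ?thesis by (simp add: nat_add_distrib)
  qed (simp add: chain_boundary_def)
  interpret N: normal "subspace_chains (n - 1) c A" "closure_chain_group (n - 1) X c"
    by (rule subspace_chains_normal[OF assms(1)])
  show ?thesis
    using rel_chain_boundary_coset[OF assms(1) a] rel_chain_boundary_coset[OF assms(1) b] zero
      N.coset_mult_one[OF N.subset]
    by (simp add: Ka rel_chain_group_def)
qed

lemma rel_boundaries_normal:
  assumes "A \<subseteq> X"
  shows "rel_boundaries n X c A \<lhd> rel_cycle_group n X c A"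
proof -
  let ?C = "\<lambda>n. rel_chain_group n X c A"
  let ?Z = "kernel (?C n) (?C (n - 1)) (rel_chain_boundary n X c A)"
  interpret C: comm_group "?C m" for m by (rule comm_group_rel_chain_group[OF assms])
  interpret D: group_hom "?C m" "?C (m - 1)" "rel_chain_boundary m X c A" for m
    by unfold_locales (rule rel_chain_boundary_hom[OF assms])
  have Z: "subgroup ?Z (?C n)" by (rule D.subgroup_kernel)
  have B: "subgroup (rel_boundaries n X c A) (?C n)"
    using D.img_is_subgroup[of "n + 1"] by (simp add: rel_boundaries_def)
  have "rel_boundaries n X c A \<subseteq> ?Z"
    using subgroup.subset[OF B] rel_chain_boundary_boundary[OF assms]
    by (auto simp: kernel_def rel_boundaries_def)
  then have sub: "subgroup (rel_boundaries n X c A) (rel_cycle_group n X c A)"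
    unfolding rel_cycle_group_def by (rule C.subgroup_incl[OF B Z])
  have "comm_group (rel_cycle_group n X c A)"
    unfolding rel_cycle_group_def
  proof (rule group.group_comm_groupI)
    show "group (?C n\<lparr>carrier := ?Z\<rparr>)" by (rule C.subgroup_imp_group[OF Z])
    fix x y assume "x \<in> carrier (?C n\<lparr>carrier := ?Z\<rparr>)" "y \<in> carrier (?C n\<lparr>carrier := ?Z\<rparr>)"
    then have "x \<in> carrier (?C n)" "y \<in> carrier (?C n)" by (simp_all add: kernel_def)
    from C.m_comm[OF this]
    show "x \<otimes>\<^bsub>?C n\<lparr>carrier := ?Z\<rparr>\<^esub> y = y \<otimes>\<^bsub>?C n\<lparr>carrier := ?Z\<rparr>\<^esub> x" by simp
  qed
  then show ?thesis using sub by (simp add: comm_group.normal_iff_subgroup)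
qed

lemma group_rel_homology:
  assumes "A \<subseteq> X"
  shows "group (rel_homology n X c A)"
  unfolding rel_homology_def by (rule normal.factorgroup_is_group[OF rel_boundaries_normal[OF assms]])

subsection \<open>Induced maps\<close>

text \<open>For a continuous map of pairs \<^term>\<open>f\<close> into \<open>(Y, B)\<close>, where \<^term>\<open>Y\<close> carries the closure
  \<^term>\<open>d\<close>: the induced maps on relative chains and on relative homology.\<close>

definition rel_chain_map ::
    "int \<Rightarrow> 'b set \<Rightarrow> ('b set \<Rightarrow> 'b set) \<Rightarrow> 'b set \<Rightarrow> ('a \<Rightarrow> 'b) \<Rightarrow> 'a chain set \<Rightarrow> 'b chain set"
  where "rel_chain_map n Y d B f =
    coset_map (closure_chain_group n Y d) (subspace_chains n d B) (chain_map (nat n) f)"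

definition rel_homology_map ::
    "int \<Rightarrow> 'b set \<Rightarrow> ('b set \<Rightarrow> 'b set) \<Rightarrow> 'b set \<Rightarrow> ('a \<Rightarrow> 'b) \<Rightarrow>
      'a chain set set \<Rightarrow> 'b chain set set"
  where "rel_homology_map n Y d B f =
    coset_map (rel_cycle_group n Y d B) (rel_boundaries n Y d B) (rel_chain_map n Y d B f)"

end

theory Submission
  imports Defs
begin

text \<open>
  Excision rests on barycentric subdivision: a singular chain is homologous to all its iterated
  subdivisions, and after enough subdivisions every simplex lies in one of two sets whose
  interiors cover the space.  The classical argument carries over to closure spaces because all
  geometry takes place on the standard simplex, which is a topological space; a
  closure-continuous simplex \<open>\<sigma>\<close> merely transports it.

  Three facts make this precise.  First, subdivision and its chain homotopy to the identity
  are both of the form ``push a fixed chain \<open>w\<close> of the standard simplex forward along \<open>\<sigma>\<close>'', and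
  composing \<open>\<sigma>\<close> with a continuous map of standard simplices is again closure-continuous; so both
  operators preserve the chains of every closure space, in particular of every subspace
  (\<open>model_operator_closure_chains\<close>).  Second, the formulas relating them to the boundary hold for
  chains of arbitrary maps on the simplex, since every map into an indiscrete space is continuous.
  Third, \<open>\<sigma>\<close> sends the closure of a set into the closure of its image, so the points
  mapped into the interior of \<open>A\<close> are topologically interior to the preimage of \<open>A\<close>
  (\<open>preimage_interior_subset\<close>).  Hence an interior cover pulls back to an open cover of the
  standard simplex, and compactness yields a Lebesgue number (\<open>fine_subdivision_simplex\<close>).

  Given an interior cover \<open>{A, B}\<close>, subdividing a relative cycle of \<open>(X, A)\<close> and discarding the
  part in \<open>A\<close> moves it into \<open>B\<close>: this is surjectivity of the map induced by the inclusion of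
  \<open>(B, A \<inter> B)\<close> (\<open>relative_cycle_excised\<close>).  Subdividing a bounding chain instead gives
  injectivity (\<open>relative_boundary_excised\<close>).  The version with an excised set \<open>Z\<close> is the case
  \<open>B = X - Z\<close>.
\<close>

section \<open>Chains of closure spaces and their subspaces\<close>

abbreviation closure_chains :: "int \<Rightarrow> 'a set \<Rightarrow> ('a set \<Rightarrow> 'a set) \<Rightarrow> 'a chain set"
  where "closure_chains n X c \<equiv> carrier (closure_chain_group n X c)"

abbreviation simplex_space :: "nat \<Rightarrow> (nat \<Rightarrow> real) topology"
  where "simplex_space p \<equiv> subtopology (powertop_real UNIV) (standard_simplex p)"

abbreviation identity_chain :: "nat \<Rightarrow> (nat \<Rightarrow> real) chain"
  where "identity_chain p \<equiv> frag_of (restrict id (standard_simplex p))"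

lemma identity_chain_simplicial: "simplicial_chain p (standard_simplex p) (identity_chain p)"
  by simp

lemma zero_closure_chains: "0 \<in> closure_chains n X c"
  by (simp add: mem_closure_chain_group)

lemma add_closure_chains:
  "a \<in> closure_chains n X c \<Longrightarrow> b \<in> closure_chains n X c \<Longrightarrow> a + b \<in> closure_chains n X c"
  using Poly_Mapping.keys_add[of a b] by (auto simp: mem_closure_chain_group)

lemma diff_closure_chains:
  "a \<in> closure_chains n X c \<Longrightarrow> b \<in> closure_chains n X c \<Longrightarrow> a - b \<in> closure_chains n X c"
  using keys_diff[of a b] by (auto simp: mem_closure_chain_group)

text \<open>Degrees range over the integers but simplices only have natural dimension.  In negative
  degrees, where \<^term>\<open>nat (n + 1)\<close> is not the successor of \<^term>\<open>nat n\<close>, the formulas below hold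
  because there are no nonzero chains.\<close>

lemma closure_chains_negative:
  assumes "n < 0"
  shows "closure_chains n X c = {0}"
  using assms by (auto simp: mem_closure_chain_group)

lemma chain_boundary_closure_chains:
  "a \<in> closure_chains n X c \<Longrightarrow> chain_boundary (nat n) a \<in> closure_chains (n - 1) X c"
  by (rule hom_in_carrier[OF chain_boundary_hom])

text \<open>The subspace closure only intersects with \<^term>\<open>A\<close>, which is automatic for images of a map into
  \<^term>\<open>A\<close>.  So being a simplex of a subspace is a condition on the image alone, and the chains of
  an intersection are the intersection of the chains.\<close>

lemma closure_simplex_subspace_iff:
  assumes "A \<subseteq> X"
  shows "closure_simplex p A (subspace_closure c A) \<sigma> \<longleftrightarrow>
    closure_simplex p X c \<sigma> \<and> \<sigma> \<in> standard_simplex p \<rightarrow> A"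
proof -
  let ?cl = "\<lambda>S. simplex_space p closure_of S"
  have "\<sigma> ` ?cl S \<subseteq> A" if "\<sigma> \<in> standard_simplex p \<rightarrow> A" for S
    using closure_of_subset_topspace[of "simplex_space p" S] that by auto
  then have "\<sigma> \<in> standard_simplex p \<rightarrow> A \<Longrightarrow> \<sigma> ` ?cl S \<subseteq> A \<inter> c (\<sigma> ` S) \<longleftrightarrow> \<sigma> ` ?cl S \<subseteq> c (\<sigma> ` S)" for S
    by (simp only: Int_subset_iff) simp
  moreover have "\<sigma> \<in> standard_simplex p \<rightarrow> A \<Longrightarrow> \<sigma> \<in> standard_simplex p \<rightarrow> X"
    using assms by blast
  ultimately show ?thesis
    unfolding closure_simplex_def closure_continuous_def subspace_closure_def
    by (cases "\<sigma> \<in> standard_simplex p \<rightarrow> A") simp_all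
qed

lemma subspace_chains_subset:
  assumes "A \<subseteq> X"
  shows "subspace_chains n c A \<subseteq> closure_chains n X c"
  using closure_simplex_subspace[OF _ assms] by (auto simp: mem_closure_chain_group)

lemma subspace_chains_Int:
  assumes "A \<subseteq> X" "B \<subseteq> X"
  shows "subspace_chains n c (A \<inter> B) = subspace_chains n c A \<inter> subspace_chains n c B"
proof -
  have AB: "A \<inter> B \<subseteq> X" using assms by blast
  have iff: "closure_simplex p (A \<inter> B) (subspace_closure c (A \<inter> B)) \<sigma> \<longleftrightarrow>
      closure_simplex p A (subspace_closure c A) \<sigma> \<and> closure_simplex p B (subspace_closure c B) \<sigma>" for p \<sigma>
    unfolding closure_simplex_subspace_iff[OF assms(1)] closure_simplex_subspace_iff[OF assms(2)]
      closure_simplex_subspace_iff[OF AB] by blast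
  show ?thesis
    by (auto simp: mem_closure_chain_group iff)
qed

lemma subspace_closure_subspace:
  "A \<subseteq> B \<Longrightarrow> subspace_closure (subspace_closure c B) A = subspace_closure c A"
  by (auto simp: subspace_closure_def fun_eq_iff)

section \<open>Subdivision of closure chains\<close>

text \<open>The pullback of the one-point space.  Every map into it is continuous, so identities proved
  for singular chains of a topological space apply to the chains of any closure space.\<close>

definition indiscrete :: "'a topology"
  where "indiscrete = pullback_topology UNIV (\<lambda>_. ()) (discrete_topology UNIV)"

lemma closure_simplex_indiscrete:
  assumes "closure_simplex p X c \<sigma>"
  shows "singular_simplex p indiscrete \<sigma>"
  using assms unfolding singular_simplex_def closure_simplex_def indiscrete_def
  by (auto intro!: continuous_map_pullback')

lemma closure_chains_indiscrete:
  "a \<in> closure_chains n X c \<Longrightarrow> singular_chain (nat n) indiscrete a"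
  by (auto simp: singular_chain_def mem_closure_chain_group intro: closure_simplex_indiscrete)

text \<open>A closure-continuous map out of a topological space may be precomposed with a continuous map,
  since both send closures into closures.\<close>

lemma closure_simplex_simplex_map:
  assumes \<sigma>: "closure_simplex p X c \<sigma>" and \<tau>: "singular_simplex q (simplex_space p) \<tau>"
  shows "closure_simplex q X c (simplex_map q \<sigma> \<tau>)"
proof -
  let ?f = "simplex_map q \<sigma> \<tau>"
  have cont: "continuous_map (simplex_space q) (simplex_space p) \<tau>"
    using \<tau> by (simp add: singular_simplex_def)
  then have \<tau>_in: "\<tau> \<in> standard_simplex q \<rightarrow> standard_simplex p"
    using continuous_map_funspace by fastforce
  have \<sigma>_in: "\<sigma> \<in> standard_simplex p \<rightarrow> X"
    using \<sigma> by (auto simp: closure_simplex_def closure_continuous_def)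
  have "?f ` (simplex_space q closure_of S) \<subseteq> c (?f ` S)" if S: "S \<subseteq> standard_simplex q" for S
  proof -
    have image: "?f ` T = \<sigma> ` \<tau> ` T" if "T \<subseteq> standard_simplex q" for T
      using that by (force simp: simplex_map_def image_image)
    have "?f ` (simplex_space q closure_of S) = \<sigma> ` \<tau> ` (simplex_space q closure_of S)"
      using image closure_of_subset_topspace[of "simplex_space q" S] by simp
    also have "\<dots> \<subseteq> \<sigma> ` (simplex_space p closure_of (\<tau> ` S))"
      by (intro image_mono continuous_map_image_closure_subset[OF cont])
    also have "\<dots> \<subseteq> c (\<sigma> ` \<tau> ` S)"
    proof -
      have "\<tau> ` S \<subseteq> standard_simplex p" using S \<tau>_in by auto
      then show ?thesis using \<sigma> by (auto simp: closure_simplex_def closure_continuous_def)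
    qed
    finally show ?thesis using image[OF S] by simp
  qed
  then show ?thesis
    using \<tau>_in \<sigma>_in unfolding closure_simplex_def closure_continuous_def
    by (auto simp: simplex_map_def)
qed

text \<open>A chain \<open>w\<close> of the standard simplex is a universal model of an operation on chains: evaluate
  it on \<open>\<sigma>\<close> by pushing \<open>w\<close> forward along \<open>\<sigma>\<close>.  For \<open>w\<close> the subdivided identity simplex this is
  \<^term>\<open>singular_subdivision\<close>, and for \<open>w\<close> the value of \<^term>\<open>subd\<close> on the identity simplex it is
  the homotopy \<open>subdivision_homotopy\<close>.\<close>

lemma model_operator_closure_chains:
  assumes a: "a \<in> closure_chains n X c" and w: "singular_chain q (simplex_space (nat n)) w"
  shows "frag_extend (\<lambda>\<sigma>. chain_map q \<sigma> w) a \<in> closure_chains (int q) X c"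
proof -
  have "closure_simplex q X c \<rho>"
    if \<rho>: "\<rho> \<in> Poly_Mapping.keys (frag_extend (\<lambda>\<sigma>. chain_map q \<sigma> w) a)" for \<rho>
  proof -
    obtain \<sigma> where \<sigma>: "\<sigma> \<in> Poly_Mapping.keys a" "\<rho> \<in> Poly_Mapping.keys (chain_map q \<sigma> w)"
      using subsetD[OF keys_frag_extend \<rho>] by blast
    then obtain \<tau> where "\<tau> \<in> Poly_Mapping.keys w" "\<rho> = simplex_map q \<sigma> \<tau>"
      unfolding chain_map_def using keys_frag_extend by fastforce
    then show ?thesis
      using closure_simplex_simplex_map \<sigma> a w
      by (fastforce simp: mem_closure_chain_group singular_chain_def)
  qed
  then show ?thesis by (simp add: mem_closure_chain_group)
qed

lemma singular_subdivision_closure_chains: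
  assumes a: "a \<in> closure_chains n X c"
  shows "singular_subdivision (nat n) a \<in> closure_chains n X c"
proof (cases "n < 0")
  case True
  then show ?thesis using a by (simp add: closure_chains_negative)
next
  case False
  have "singular_chain (nat n) (simplex_space (nat n))
      (simplicial_subdivision (nat n) (identity_chain (nat n)))"
    by (intro simplicial_imp_singular_chain simplicial_chain_simplicial_subdivision
        identity_chain_simplicial)
  from model_operator_closure_chains[OF a this] False
  show ?thesis by (simp add: singular_subdivision_def)
qed

lemma singular_subdivision_power_closure_chains:
  "a \<in> closure_chains n X c \<Longrightarrow> (singular_subdivision (nat n) ^^ m) a \<in> closure_chains n X c"
  by (induction m) (simp_all add: singular_subdivision_closure_chains)

lemma chain_boundary_singular_subdivision_power:
  assumes "singular_chain p T a"
  shows "chain_boundary p ((singular_subdivision p ^^ m) a) =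
    (singular_subdivision (p - Suc 0) ^^ m) (chain_boundary p a)"
proof (induction m)
  case (Suc m)
  have "singular_chain p T ((singular_subdivision p ^^ m) a)"
    by (induction m) (simp_all add: assms singular_chain_singular_subdivision)
  then show ?case using Suc by (simp add: chain_boundary_singular_subdivision)
qed simp

section \<open>A chain is homologous to its subdivisions\<close>

text \<open>\<open>chain_homotopic_singular_subdivision\<close> asserts the existence of a chain homotopy that
  preserves the singular chains of topological spaces.  To know that it preserves the chains of
  closure spaces as well, it is written here as a model operator.\<close>

definition subdivision_homotopy :: "nat \<Rightarrow> 'a chain \<Rightarrow> 'a chain"
  where "subdivision_homotopy p =
    frag_extend (\<lambda>\<sigma>. chain_map (Suc p) \<sigma> (subd p (identity_chain p)))"

lemma subd_identity_chain:
  "simplicial_chain (Suc p) (standard_simplex p) (subd p (identity_chain p))"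
  using chain_homotopic_simplicial_subdivision2 identity_chain_simplicial by blast

text \<open>Naturality of \<^term>\<open>subd\<close> under affine maps, transported along \<open>\<sigma>\<close>.  It is needed for \<open>w\<close> the
  boundary of the identity simplex, where it says that restricting \<open>\<sigma>\<close> to a face commutes
  with the homotopy.\<close>

lemma subdivision_homotopy_chain_map:
  assumes "simplicial_chain q (standard_simplex p) w"
  shows "subdivision_homotopy q (chain_map q \<sigma> w) = chain_map (Suc q) \<sigma> (subd q w)"
  using assms unfolding simplicial_chain_def
proof (induction w rule: frag_induction)
  case (one f)
  then have f: "simplicial_simplex q (standard_simplex p) f" by simp
  let ?d = "subd q (identity_chain q)"
  have "chain_map q f (identity_chain q) = frag_of f"
    using f singular_simplex_chain_map_id by (auto simp: simplicial_simplex_def)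
  then have "chain_map (Suc q) \<sigma> (subd q (frag_of f)) = chain_map (Suc q) (\<sigma> \<circ> f) ?d"
    using chain_homotopic_simplicial_subdivision1[OF identity_chain_simplicial f]
    by (simp add: chain_map_compose)
  also have "\<dots> = chain_map (Suc q) (simplex_map q \<sigma> f) ?d"
    by (rule chain_map_eq[OF simplicial_imp_singular_chain[OF subd_identity_chain]])
      (simp add: simplex_map_def)
  finally show ?case by (simp add: subdivision_homotopy_def)
qed (auto simp: subdivision_homotopy_def chain_map_diff frag_extend_diff)

text \<open>Evaluated on \<open>\<sigma>\<close>, this is the push-forward along \<open>\<sigma>\<close> of the homotopy formula for \<^term>\<open>subd\<close> on
  the identity simplex; only the term containing the boundary needs naturality.\<close>

lemma chain_boundary_subdivision_homotopy:
  assumes "singular_chain p T a"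
  shows "chain_boundary (Suc p) (subdivision_homotopy p a) +
    subdivision_homotopy (p - Suc 0) (chain_boundary p a) = singular_subdivision p a - a"
  using assms unfolding singular_chain_def
proof (induction a rule: frag_induction)
  case (one \<sigma>)
  let ?i = "identity_chain p"
  let ?d = "subd (p - Suc 0) (chain_boundary p ?i)"
  have \<sigma>: "chain_map p \<sigma> ?i = frag_of \<sigma>"
    using one singular_simplex_chain_map_id by blast
  have "chain_boundary (Suc p) (subdivision_homotopy p (frag_of \<sigma>)) =
      chain_map p \<sigma> (chain_boundary (Suc p) (subd p ?i))"
    using chain_boundary_chain_map[OF simplicial_imp_singular_chain[OF subd_identity_chain]]
    by (simp add: subdivision_homotopy_def)
  also have "\<dots> = singular_subdivision p (frag_of \<sigma>) - frag_of \<sigma> - chain_map p \<sigma> ?d"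
    unfolding chain_homotopic_simplicial_subdivision3[OF identity_chain_simplicial] chain_map_diff \<sigma>
    by (simp add: singular_subdivision_def)
  also have "chain_map p \<sigma> ?d = subdivision_homotopy (p - Suc 0) (chain_boundary p (frag_of \<sigma>))"
  proof (cases "p = 0")
    case True
    then show ?thesis by (simp add: subdivision_homotopy_def chain_boundary_def)
  next
    case False
    have "chain_boundary p (frag_of \<sigma>) = chain_map (p - Suc 0) \<sigma> (chain_boundary p ?i)"
      unfolding \<sigma>[symmetric]
      by (rule chain_boundary_chain_map[OF simplicial_imp_singular_chain[OF identity_chain_simplicial]])
    then show ?thesis
      using False
        subdivision_homotopy_chain_map[OF simplicial_chain_boundary[OF identity_chain_simplicial], of p \<sigma>]
      by simp
  qed
  finally show ?case by simp
next
  case (diff a b)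
  let ?h = "\<lambda>a. chain_boundary (Suc p) (subdivision_homotopy p a) +
    subdivision_homotopy (p - Suc 0) (chain_boundary p a)"
  have "?h (a - b) = ?h a - ?h b"
    by (simp add: subdivision_homotopy_def chain_boundary_diff frag_extend_diff)
  also have "\<dots> = singular_subdivision p (a - b) - (a - b)"
    unfolding diff singular_subdivision_diff by simp
  finally show ?case .
qed (simp add: subdivision_homotopy_def)

lemma subdivision_homotopy_closure_chains:
  assumes a: "a \<in> closure_chains n X c"
  shows "subdivision_homotopy (nat n) a \<in> closure_chains (n + 1) X c"
proof (cases "n < 0")
  case True
  then show ?thesis
    using a by (simp add: closure_chains_negative subdivision_homotopy_def zero_closure_chains)
next
  case False
  from model_operator_closure_chains[OF a simplicial_imp_singular_chain[OF subd_identity_chain]] False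
  show ?thesis by (simp add: subdivision_homotopy_def add.commute)
qed

text \<open>If \<open>h\<close> is the subdivision homotopy then the subdivision of \<open>a\<close> differs from \<open>a\<close> by
  a boundary plus \<open>h\<close> of the boundary of \<open>a\<close>, and the latter stays among the chains that
  contain the boundary of \<open>a\<close>.  Subdividing \<open>a\<close> preserves the hypotheses, so the step can be
  iterated.\<close>

lemma singular_subdivision_power_homologous:
  assumes a: "a \<in> closure_chains n X c" and bdry_a: "chain_boundary (nat n) a \<in> closure_chains (n - 1) A d"
  shows "\<exists>u\<in>closure_chains (n + 1) X c.
    (singular_subdivision (nat n) ^^ m) a - a - chain_boundary (nat (n + 1)) u \<in> closure_chains n A d"
proof (induction m)
  case 0
  then show ?case using zero_closure_chains[of "n + 1"] zero_closure_chains[of n] by force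
next
  case (Suc m)
  then obtain u where u: "u \<in> closure_chains (n + 1) X c"
    "(singular_subdivision (nat n) ^^ m) a - a - chain_boundary (nat (n + 1)) u \<in> closure_chains n A d"
    by blast
  let ?b = "(singular_subdivision (nat n) ^^ m) a"
  let ?h = "subdivision_homotopy (nat n) ?b"
  have b: "?b \<in> closure_chains n X c"
    using a by (rule singular_subdivision_power_closure_chains)
  have pred: "nat n - Suc 0 = nat (n - 1)" by simp
  have bdry_b: "chain_boundary (nat n) ?b \<in> closure_chains (n - 1) A d"
    using chain_boundary_singular_subdivision_power[OF closure_chains_indiscrete[OF a]]
      singular_subdivision_power_closure_chains[OF bdry_a] pred by metis
  have "chain_boundary (nat (n + 1)) ?h + subdivision_homotopy (nat (n - 1)) (chain_boundary (nat n) ?b)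
      = singular_subdivision (nat n) ?b - ?b"
  proof (cases "n < 0")
    case True
    then have "?b = 0" using b by (simp add: closure_chains_negative)
    then show ?thesis by (simp add: subdivision_homotopy_def)
  next
    case False
    then show ?thesis
      using chain_boundary_subdivision_homotopy[OF closure_chains_indiscrete[OF b]] pred
      by (simp add: Suc_nat_eq_nat_zadd1 add.commute)
  qed
  then have eq: "(singular_subdivision (nat n) ^^ Suc m) a - a - chain_boundary (nat (n + 1)) (u + ?h) =
      (?b - a - chain_boundary (nat (n + 1)) u) +
      subdivision_homotopy (nat (n - 1)) (chain_boundary (nat n) ?b)"
    by (simp add: chain_boundary_add algebra_simps)
  have "subdivision_homotopy (nat (n - 1)) (chain_boundary (nat n) ?b) \<in> closure_chains n A d"
    using subdivision_homotopy_closure_chains[OF bdry_b] by simp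
  then have "(singular_subdivision (nat n) ^^ Suc m) a - a - chain_boundary (nat (n + 1)) (u + ?h)
      \<in> closure_chains n A d"
    unfolding eq by (rule add_closure_chains[OF u(2)])
  moreover have "u + ?h \<in> closure_chains (n + 1) X c"
    by (intro add_closure_chains u(1) subdivision_homotopy_closure_chains b)
  ultimately show ?case by blast
qed

section \<open>Sufficiently fine subdivisions\<close>

lemma (in closure_space) closure_mono:
  assumes "A \<subseteq> B" "B \<subseteq> X"
  shows "c A \<subseteq> c B"
  using closure_union[of A B] assms by (auto simp: Un_absorb1)

text \<open>If \<open>t\<close> were in the closure of the points that \<open>\<sigma>\<close> maps outside \<open>A\<close>, then
  \<open>\<sigma> t\<close> would be in the closure of the complement of \<open>A\<close>.  This replaces the preimage of an
  open set being open: the interior of \<open>A\<close> need not be its own interior, so its preimage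
  need not be open.\<close>

lemma (in closure_space) preimage_interior_subset:
  assumes \<sigma>: "closure_simplex p X c \<sigma>" and "A \<subseteq> X"
    and t: "t \<in> standard_simplex p" "\<sigma> t \<in> closure_interior X c A"
  shows "t \<in> simplex_space p interior_of {t \<in> standard_simplex p. \<sigma> t \<in> A}"
proof -
  let ?U = "{t \<in> standard_simplex p. \<sigma> t \<in> A}"
  let ?V = "standard_simplex p - ?U"
  have "\<sigma> ` ?V \<subseteq> X - A"
    using \<sigma> by (auto simp: closure_simplex_def closure_continuous_def)
  then have "c (\<sigma> ` ?V) \<subseteq> c (X - A)" by (rule closure_mono) simp
  moreover have "\<sigma> ` (simplex_space p closure_of ?V) \<subseteq> c (\<sigma> ` ?V)"
    using \<sigma> by (simp add: closure_simplex_def closure_continuous_def)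
  ultimately have "t \<notin> simplex_space p closure_of ?V"
    using t(2) by (auto simp: closure_interior_def)
  then show ?thesis
    using t(1) by (simp add: interior_of_closure_of)
qed

lemma naturality_singular_subdivision_power:
  assumes "singular_chain p T a"
  shows "(singular_subdivision p ^^ m) (chain_map p g a) =
    chain_map p g ((singular_subdivision p ^^ m) a)"
proof (induction m)
  case (Suc m)
  have "singular_chain p T ((singular_subdivision p ^^ m) a)"
    by (induction m) (simp_all add: assms singular_chain_singular_subdivision)
  then show ?case using Suc by (simp add: naturality_singular_subdivision)
qed simp

text \<open>The subdivision of \<open>\<sigma>\<close> is the push-forward of that of the identity simplex, so it is
  enough to make the latter fine with respect to the pulled-back open cover of the
  standard simplex.\<close>

lemma (in closure_space) fine_subdivision_simplex:
  assumes \<sigma>: "closure_simplex p X c \<sigma>" and cover: "interior_cover X c \<U>"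
  shows "\<exists>N. \<forall>m\<ge>N. \<forall>\<rho>\<in>Poly_Mapping.keys ((singular_subdivision p ^^ m) (frag_of \<sigma>)).
    \<exists>U\<in>\<U>. \<rho> \<in> standard_simplex p \<rightarrow> U"
proof -
  let ?V = "\<lambda>U. simplex_space p interior_of {t \<in> standard_simplex p. \<sigma> t \<in> U}"
  have id: "singular_chain p (simplex_space p) (identity_chain p)"
    by (intro simplicial_imp_singular_chain identity_chain_simplicial)
  have covered: "topspace (simplex_space p) \<subseteq> \<Union>(?V ` \<U>)"
  proof
    fix t assume "t \<in> topspace (simplex_space p)"
    then have t: "t \<in> standard_simplex p" by simp
    then have "\<sigma> t \<in> X" using \<sigma> by (auto simp: closure_simplex_def closure_continuous_def)
    then obtain U where "U \<in> \<U>" "U \<subseteq> X" "\<sigma> t \<in> closure_interior X c U"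
      using cover unfolding interior_cover_def by blast
    then show "t \<in> \<Union>(?V ` \<U>)" using preimage_interior_subset[OF \<sigma> _ t] by blast
  qed
  obtain N where N: "\<And>m \<tau>. N \<le> m \<Longrightarrow>
      \<tau> \<in> Poly_Mapping.keys ((singular_subdivision p ^^ m) (identity_chain p)) \<Longrightarrow>
      \<exists>V\<in>?V ` \<U>. \<tau> \<in> standard_simplex p \<rightarrow> V"
    by (rule sufficient_iterated_singular_subdivision_exists[OF _ covered id]) auto
  have "\<exists>U\<in>\<U>. \<rho> \<in> standard_simplex p \<rightarrow> U"
    if m: "N \<le> m" and \<rho>: "\<rho> \<in> Poly_Mapping.keys ((singular_subdivision p ^^ m) (frag_of \<sigma>))" for m \<rho>
  proof -
    have "frag_of \<sigma> = chain_map p \<sigma> (identity_chain p)"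
      using singular_simplex_chain_map_id[OF closure_simplex_indiscrete[OF \<sigma>]] by simp
    then have "\<rho> \<in> Poly_Mapping.keys (chain_map p \<sigma> ((singular_subdivision p ^^ m) (identity_chain p)))"
      using \<rho> naturality_singular_subdivision_power[OF id] by metis
    then obtain \<tau> where \<tau>: "\<tau> \<in> Poly_Mapping.keys ((singular_subdivision p ^^ m) (identity_chain p))"
      "\<rho> = simplex_map p \<sigma> \<tau>"
      unfolding chain_map_def using keys_frag_extend by fastforce
    then obtain U where "U \<in> \<U>" "\<tau> \<in> standard_simplex p \<rightarrow> ?V U" using N[OF m] by blast
    moreover have "?V U \<subseteq> {t \<in> standard_simplex p. \<sigma> t \<in> U}" by (rule interior_of_subset)
    ultimately show ?thesis using \<tau>(2) by (auto simp: simplex_map_def intro!: bexI[of _ U])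
  qed
  then show ?thesis by blast
qed

lemma (in closure_space) fine_subdivision:
  assumes a: "a \<in> closure_chains n X c" and cover: "interior_cover X c \<U>"
  shows "\<exists>N. \<forall>m\<ge>N. \<forall>\<rho>\<in>Poly_Mapping.keys ((singular_subdivision (nat n) ^^ m) a).
    \<exists>U\<in>\<U>. \<rho> \<in> standard_simplex (nat n) \<rightarrow> U"
proof -
  have "Poly_Mapping.keys a \<subseteq> {\<sigma>. closure_simplex (nat n) X c \<sigma>}"
    using a by (auto simp: mem_closure_chain_group)
  then show ?thesis
  proof (induction a rule: frag_induction)
    case (one \<sigma>)
    then show ?case using fine_subdivision_simplex[OF _ cover] by simp
  next
    case (diff a b)
    from diff(1) obtain N where
      N: "\<forall>m\<ge>N. \<forall>\<rho>\<in>Poly_Mapping.keys ((singular_subdivision (nat n) ^^ m) a).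
        \<exists>U\<in>\<U>. \<rho> \<in> standard_simplex (nat n) \<rightarrow> U" ..
    from diff(2) obtain M where
      M: "\<forall>m\<ge>M. \<forall>\<rho>\<in>Poly_Mapping.keys ((singular_subdivision (nat n) ^^ m) b).
        \<exists>U\<in>\<U>. \<rho> \<in> standard_simplex (nat n) \<rightarrow> U" ..
    show ?case
    proof (intro exI[of _ "max N M"] allI impI ballI)
      fix m \<rho> assume m: "max N M \<le> m"
        and \<rho>: "\<rho> \<in> Poly_Mapping.keys ((singular_subdivision (nat n) ^^ m) (a - b))"
      have "\<rho> \<in> Poly_Mapping.keys ((singular_subdivision (nat n) ^^ m) a) \<union>
          Poly_Mapping.keys ((singular_subdivision (nat n) ^^ m) b)"
        by (rule subsetD[OF keys_diff \<rho>[unfolded singular_subdivision_power_diff]])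
      then show "\<exists>U\<in>\<U>. \<rho> \<in> standard_simplex (nat n) \<rightarrow> U" using N M m by auto
    qed
  qed simp
qed

lemma (in closure_space) subdivision_splits:
  assumes a: "a \<in> closure_chains n X c" and cover: "interior_cover X c {A, B}"
  shows "\<exists>m. \<exists>a\<^sub>A\<in>subspace_chains n c A. \<exists>a\<^sub>B\<in>subspace_chains n c B.
    (singular_subdivision (nat n) ^^ m) a = a\<^sub>A + a\<^sub>B"
proof (cases "n < 0")
  case True
  then show ?thesis
    using a by (auto simp: closure_chains_negative intro!: exI[of _ 0])
next
  case False
  have AB: "A \<subseteq> X" "B \<subseteq> X" using cover by (auto simp: interior_cover_def)
  obtain m where m: "\<forall>\<rho>\<in>Poly_Mapping.keys ((singular_subdivision (nat n) ^^ m) a).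
      \<exists>U\<in>{A, B}. \<rho> \<in> standard_simplex (nat n) \<rightarrow> U"
    using fine_subdivision[OF a cover] by blast
  let ?S = "\<lambda>A. {\<sigma>. closure_simplex (nat n) A (subspace_closure c A) \<sigma>}"
  have "Poly_Mapping.keys ((singular_subdivision (nat n) ^^ m) a) \<subseteq> ?S A \<union> ?S B"
    using m singular_subdivision_power_closure_chains[OF a, of m]
    unfolding mem_closure_chain_group
    by (auto simp: closure_simplex_subspace_iff[OF AB(1)] closure_simplex_subspace_iff[OF AB(2)])
  then obtain d e where de: "Poly_Mapping.keys d \<subseteq> ?S A" "Poly_Mapping.keys e \<subseteq> ?S B"
    "d + e = (singular_subdivision (nat n) ^^ m) a"
    by (rule frag_split)
  have "d \<in> subspace_chains n c A" "e \<in> subspace_chains n c B"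
    using de(1,2) False by (simp_all add: mem_closure_chain_group subset_iff)
  then show ?thesis using de(3)[symmetric] by blast
qed

section \<open>Excision for chains\<close>

text \<open>Write a fine subdivision of \<open>a\<close> as \<open>a\<^sub>A + a\<^sub>B\<close> and take \<open>b = a\<^sub>B\<close>.  Its boundary lies in \<open>B\<close>
  because \<open>a\<^sub>B\<close> does, and in \<open>A\<close> because it differs from the subdivided boundary of \<open>a\<close> by
  the boundary of \<open>a\<^sub>A\<close>.\<close>

lemma (in closure_space) relative_cycle_excised:
  assumes cover: "interior_cover X c {A, B}"
    and a: "a \<in> closure_chains n X c" and bdry_a: "chain_boundary (nat n) a \<in> subspace_chains (n - 1) c A"
  shows "\<exists>b\<in>subspace_chains n c B. chain_boundary (nat n) b \<in> subspace_chains (n - 1) c (A \<inter> B) \<and>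
    (\<exists>u\<in>closure_chains (n + 1) X c. a - b - chain_boundary (nat (n + 1)) u \<in> subspace_chains n c A)"
proof -
  have AB: "A \<subseteq> X" "B \<subseteq> X" using cover by (auto simp: interior_cover_def)
  obtain m a\<^sub>A a\<^sub>B where split: "(singular_subdivision (nat n) ^^ m) a = a\<^sub>A + a\<^sub>B"
    and a\<^sub>A: "a\<^sub>A \<in> subspace_chains n c A" and a\<^sub>B: "a\<^sub>B \<in> subspace_chains n c B"
    using subdivision_splits[OF a cover] by blast
  have pred: "nat n - Suc 0 = nat (n - 1)" by simp
  have "chain_boundary (nat n) a\<^sub>A + chain_boundary (nat n) a\<^sub>B =
      (singular_subdivision (nat (n - 1)) ^^ m) (chain_boundary (nat n) a)"
    unfolding pred[symmetric] using chain_boundary_singular_subdivision_power[OF closure_chains_indiscrete[OF a], of m]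
    by (simp add: split chain_boundary_add)
  then have "chain_boundary (nat n) a\<^sub>B =
      (singular_subdivision (nat (n - 1)) ^^ m) (chain_boundary (nat n) a) - chain_boundary (nat n) a\<^sub>A"
    by (simp add: algebra_simps)
  then have "chain_boundary (nat n) a\<^sub>B \<in> subspace_chains (n - 1) c A"
    using diff_closure_chains[OF singular_subdivision_power_closure_chains[OF bdry_a]
        chain_boundary_closure_chains[OF a\<^sub>A]] by simp
  then have "chain_boundary (nat n) a\<^sub>B \<in> subspace_chains (n - 1) c (A \<inter> B)"
    using chain_boundary_closure_chains[OF a\<^sub>B] subspace_chains_Int[OF AB] by blast
  moreover obtain u where u: "u \<in> closure_chains (n + 1) X c"
    "a\<^sub>A + a\<^sub>B - a - chain_boundary (nat (n + 1)) u \<in> subspace_chains n c A"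
    using singular_subdivision_power_homologous[OF a bdry_a, of m] unfolding split by blast
  have "a - a\<^sub>B - chain_boundary (nat (n + 1)) (0 - u) \<in> subspace_chains n c A"
    using diff_closure_chains[OF a\<^sub>A u(2)] by (simp add: chain_boundary_diff chain_boundary_minus algebra_simps)
  moreover have "0 - u \<in> closure_chains (n + 1) X c"
    by (intro diff_closure_chains zero_closure_chains u(1))
  ultimately show ?thesis using a\<^sub>B by blast
qed

text \<open>Here the bounding chain \<open>u\<close> is subdivided until it splits as \<open>u\<^sub>A + u\<^sub>B\<close>.  The subdivision
  of \<open>b\<close> minus the boundary of \<open>u\<^sub>B\<close> lies in \<open>B\<close> by construction, and in \<open>A\<close> because it equals
  the boundary of \<open>u\<^sub>A\<close> plus the subdivision of the given error term in \<open>A\<close>.  Finally,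
  inside the pair \<open>(B, A \<inter> B)\<close>, \<open>b\<close> is homologous to its own subdivision.\<close>

lemma (in closure_space) relative_boundary_excised:
  assumes cover: "interior_cover X c {A, B}"
    and b: "b \<in> subspace_chains n c B"
    and bdry_b: "chain_boundary (nat n) b \<in> subspace_chains (n - 1) c (A \<inter> B)"
    and u: "u \<in> closure_chains (n + 1) X c"
    and bu: "b - chain_boundary (nat (n + 1)) u \<in> subspace_chains n c A"
  shows "\<exists>v\<in>subspace_chains (n + 1) c B.
    b - chain_boundary (nat (n + 1)) v \<in> subspace_chains n c (A \<inter> B)"
proof -
  have AB: "A \<subseteq> X" "B \<subseteq> X" using cover by (auto simp: interior_cover_def)
  let ?D = "chain_boundary (nat (n + 1))"
  let ?e = "b - ?D u"
  obtain m u\<^sub>A u\<^sub>B where split: "(singular_subdivision (nat (n + 1)) ^^ m) u = u\<^sub>A + u\<^sub>B"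
    and u\<^sub>A: "u\<^sub>A \<in> subspace_chains (n + 1) c A" and u\<^sub>B: "u\<^sub>B \<in> subspace_chains (n + 1) c B"
    using subdivision_splits[OF u cover] by blast
  let ?S = "singular_subdivision (nat n) ^^ m"
  have "?D u\<^sub>A + ?D u\<^sub>B = ?S (?D u)"
  proof -
    have "nat (n + 1) - Suc 0 = nat n" by simp
    then show ?thesis
      using chain_boundary_singular_subdivision_power[OF closure_chains_indiscrete[OF u], of m]
      by (simp add: split chain_boundary_add)
  qed
  moreover have "?S b = ?S (?D u) + ?S ?e"
    using singular_subdivision_power_diff[of m "nat n" b "?D u"] by simp
  ultimately have eq: "?S b - ?D u\<^sub>B = ?D u\<^sub>A + ?S ?e" by (simp add: algebra_simps)
  have in_A: "?D u\<^sub>A + ?S ?e \<in> subspace_chains n c A"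
    using chain_boundary_closure_chains[OF u\<^sub>A] singular_subdivision_power_closure_chains[OF bu]
    by (intro add_closure_chains) simp_all
  have in_B: "?S b - ?D u\<^sub>B \<in> subspace_chains n c B"
    using chain_boundary_closure_chains[OF u\<^sub>B] singular_subdivision_power_closure_chains[OF b]
    by (intro diff_closure_chains) simp_all
  have rest: "?S b - ?D u\<^sub>B \<in> subspace_chains n c (A \<inter> B)"
    using in_A in_B eq subspace_chains_Int[OF AB] by simp
  obtain w where w: "w \<in> subspace_chains (n + 1) c B"
    "?S b - b - ?D w \<in> subspace_chains n c (A \<inter> B)"
    using singular_subdivision_power_homologous[OF b bdry_b] by blast
  have "b - ?D (u\<^sub>B - w) \<in> subspace_chains n c (A \<inter> B)"
    using diff_closure_chains[OF rest w(2)] by (simp add: chain_boundary_diff algebra_simps)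
  then show ?thesis using diff_closure_chains[OF u\<^sub>B w(1)] by blast
qed

section \<open>From chains to relative homology\<close>

text \<open>Bijectivity on quotients, expressed by representatives, so that the two chain-level
  results apply without describing cosets of cosets.\<close>

lemma coset_map_iso:
  assumes h: "h \<in> hom G H" and N: "N \<lhd> G" and M: "M \<lhd> H" and hN: "h ` N \<subseteq> M"
    and inj: "\<And>x. x \<in> carrier G \<Longrightarrow> h x \<in> M \<Longrightarrow> x \<in> N"
    and surj: "\<And>y. y \<in> carrier H \<Longrightarrow> \<exists>x\<in>carrier G. y \<in> M #>\<^bsub>H\<^esub> h x"
  shows "coset_map H M h \<in> iso (G Mod N) (H Mod M)"
proof -
  interpret N: normal N G by fact
  interpret M: normal M H by fact
  note cm = coset_map_coset[OF h N M hN]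
  interpret f: group_hom "G Mod N" "H Mod M" "coset_map H M h"
    by (intro group_hom.intro group_hom_axioms.intro N.factorgroup_is_group M.factorgroup_is_group
        coset_map_hom assms)
  show ?thesis
    unfolding f.iso_iff
  proof (intro conjI subsetI ballI impI)
    fix K assume "K \<in> carrier (H Mod M)"
    then obtain y where y: "y \<in> carrier H" "K = M #>\<^bsub>H\<^esub> y" by (auto simp: carrier_FactGroup)
    then obtain x where x: "x \<in> carrier G" "y \<in> M #>\<^bsub>H\<^esub> h x" using surj by blast
    have "K = coset_map H M h (N #>\<^bsub>G\<^esub> x)"
      using M.repr_independence[OF x(2)] hom_in_carrier[OF h x(1)] M.is_subgroup y(2) cm[OF x(1)]
      by simp
    then show "K \<in> coset_map H M h ` carrier (G Mod N)"
      using x(1) by (auto simp: carrier_FactGroup)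
  next
    fix K assume "K \<in> carrier (G Mod N)" and one: "coset_map H M h K = \<one>\<^bsub>H Mod M\<^esub>"
    then obtain x where x: "x \<in> carrier G" "K = N #>\<^bsub>G\<^esub> x" by (auto simp: carrier_FactGroup)
    then have "M #>\<^bsub>H\<^esub> h x = M" using one cm by simp
    then have "h x \<in> M"
      using M.coset_join1 hom_in_carrier[OF h x(1)] M.is_subgroup M.subset by blast
    then show "K = \<one>\<^bsub>G Mod N\<^esub>"
      using inj[OF x(1)] x N.coset_join2 N.is_subgroup by simp
  qed
qed

abbreviation chain_coset :: "int \<Rightarrow> 'a set \<Rightarrow> ('a set \<Rightarrow> 'a set) \<Rightarrow> 'a set \<Rightarrow> 'a chain \<Rightarrow> 'a chain set"
  where "chain_coset n X c A a \<equiv> subspace_chains n c A #>\<^bsub>closure_chain_group n X c\<^esub> a"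

lemma chain_coset_eq_iff:
  "chain_coset n X c A a = chain_coset n X c A b \<longleftrightarrow> a - b \<in> subspace_chains n c A"
proof
  assume "chain_coset n X c A a = chain_coset n X c A b"
  moreover have "a \<in> chain_coset n X c A a"
    using zero_closure_chains by (force simp: r_coset_def)
  ultimately show "a - b \<in> subspace_chains n c A" by (auto simp: r_coset_def)
next
  assume ab: "a - b \<in> subspace_chains n c A"
  have "k + a \<in> chain_coset n X c A b" if "k \<in> subspace_chains n c A" for k
    using add_closure_chains[OF that ab] by (force simp: r_coset_def algebra_simps)
  moreover have "k + b \<in> chain_coset n X c A a" if "k \<in> subspace_chains n c A" for k
    using diff_closure_chains[OF that ab] by (force simp: r_coset_def algebra_simps)
  ultimately show "chain_coset n X c A a = chain_coset n X c A b" by (auto simp: r_coset_def)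
qed

lemma one_rel_chain_group: "\<one>\<^bsub>rel_chain_group n X c A\<^esub> = chain_coset n X c A 0"
  by (auto simp: rel_chain_group_def r_coset_def)

lemma carrier_rel_chain_group:
  "carrier (rel_chain_group n X c A) = chain_coset n X c A ` closure_chains n X c"
  by (auto simp: rel_chain_group_def carrier_FactGroup)

lemma mem_rel_cycle_group:
  assumes "A \<subseteq> X"
  shows "K \<in> carrier (rel_cycle_group n X c A) \<longleftrightarrow>
    (\<exists>a\<in>closure_chains n X c. K = chain_coset n X c A a \<and>
      chain_boundary (nat n) a \<in> subspace_chains (n - 1) c A)"
proof -
  have cycle: "rel_chain_boundary n X c A (chain_coset n X c A a) = \<one>\<^bsub>rel_chain_group (n - 1) X c A\<^esub> \<longleftrightarrow>
      chain_boundary (nat n) a \<in> subspace_chains (n - 1) c A"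
    if "a \<in> closure_chains n X c" for a
    by (simp only: rel_chain_boundary_coset[OF assms that] one_rel_chain_group chain_coset_eq_iff
        diff_zero)
  have "K \<in> carrier (rel_cycle_group n X c A) \<longleftrightarrow>
      K \<in> chain_coset n X c A ` closure_chains n X c \<and>
      rel_chain_boundary n X c A K = \<one>\<^bsub>rel_chain_group (n - 1) X c A\<^esub>"
    by (simp add: rel_cycle_group_def kernel_def carrier_rel_chain_group)
  also have "\<dots> \<longleftrightarrow> (\<exists>a\<in>closure_chains n X c. K = chain_coset n X c A a \<and>
      rel_chain_boundary n X c A (chain_coset n X c A a) = \<one>\<^bsub>rel_chain_group (n - 1) X c A\<^esub>)"
    unfolding image_iff by blast
  also have "\<dots> \<longleftrightarrow> (\<exists>a\<in>closure_chains n X c. K = chain_coset n X c A a \<and>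
      chain_boundary (nat n) a \<in> subspace_chains (n - 1) c A)"
    using cycle by (intro bex_cong) simp_all
  finally show ?thesis .
qed

lemma chain_coset_rel_boundaries_iff:
  assumes "A \<subseteq> X"
  shows "chain_coset n X c A a \<in> rel_boundaries n X c A \<longleftrightarrow>
    (\<exists>u\<in>closure_chains (n + 1) X c. a - chain_boundary (nat (n + 1)) u \<in> subspace_chains n c A)"
  unfolding rel_boundaries_def carrier_rel_chain_group image_image
  by (simp add: rel_chain_boundary_coset[OF assms] chain_coset_eq_iff image_iff cong: bex_cong)

lemma chain_coset_mult:
  assumes "A \<subseteq> X" "a \<in> closure_chains n X c" "b \<in> closure_chains n X c"
  shows "chain_coset n X c A a \<otimes>\<^bsub>rel_cycle_group n X c A\<^esub> chain_coset n X c A b =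
    chain_coset n X c A (a + b)"
proof -
  interpret N: normal "subspace_chains n c A" "closure_chain_group n X c"
    by (rule subspace_chains_normal[OF assms(1)])
  show ?thesis
    using N.rcos_sum[OF assms(2,3)] by (simp add: rel_cycle_group_def rel_chain_group_def)
qed

lemma chain_map_ident_closure_chains:
  assumes "a \<in> closure_chains n X c"
  shows "chain_map (nat n) (\<lambda>x. x) a = a"
  using chain_map_id_gen[OF closure_chains_indiscrete[OF assms]] by simp

lemma chain_map_inclusion_hom:
  assumes "B \<subseteq> X"
  shows "chain_map (nat n) (\<lambda>x. x) \<in>
    hom (closure_chain_group n B (subspace_closure c B)) (closure_chain_group n X c)"
  using subspace_chains_subset[OF assms, of n c]
  by (auto simp: hom_def chain_map_add chain_map_ident_closure_chains)

text \<open>Extensionality of simplices makes the chain map of an inclusion the identity on chains, so on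
  relative chains it only enlarges the coset.\<close>

lemma rel_chain_map_inclusion:
  assumes "A \<subseteq> X" "B \<subseteq> X" and b: "b \<in> subspace_chains n c B"
  shows "rel_chain_map n X c A (\<lambda>x. x) (chain_coset n B (subspace_closure c B) (A \<inter> B) b) =
    chain_coset n X c A b"
proof -
  have "subspace_chains n (subspace_closure c B) (A \<inter> B) \<subseteq> subspace_chains n c A"
    by (simp add: subspace_closure_subspace subspace_chains_Int[OF assms(1,2)])
  then have "chain_map (nat n) (\<lambda>x. x) ` subspace_chains n (subspace_closure c B) (A \<inter> B) \<subseteq>
      subspace_chains n c A"
    by (auto simp: chain_map_ident_closure_chains)
  then show ?thesis
    unfolding rel_chain_map_def
    using coset_map_coset[OF chain_map_inclusion_hom[OF assms(2)]
        subspace_chains_normal[of "A \<inter> B" B] subspace_chains_normal[OF assms(1)] _ b]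
    by (simp add: chain_map_ident_closure_chains[OF b])
qed

text \<open>Relative cycles and boundaries can be recognised on representing chains, so
  \<open>relative_boundary_excised\<close> gives injectivity and \<open>relative_cycle_excised\<close> surjectivity.\<close>

theorem (in closure_space) excision_iso:
  assumes cover: "interior_cover X c {A, B}"
  shows "rel_homology_map n X c A (\<lambda>x. x) \<in>
    iso (rel_homology n B (subspace_closure c B) (A \<inter> B)) (rel_homology n X c A)"
proof -
  have A: "A \<subseteq> X" and B: "B \<subseteq> X" and AB: "A \<inter> B \<subseteq> B"
    using cover by (auto simp: interior_cover_def)
  let ?d = "subspace_closure c B"
  let ?f = "rel_chain_map n X c A (\<lambda>x. x)"
  note f = rel_chain_map_inclusion[OF A B]
  have d: "subspace_closure ?d (A \<inter> B) = subspace_closure c (A \<inter> B)"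
    by (rule subspace_closure_subspace[OF AB])
  note cycle_B = mem_rel_cycle_group[OF AB, of _ n ?d]
  note boundary_B = chain_coset_rel_boundaries_iff[OF AB, of n ?d]
  have sub: "subspace_chains n c B \<subseteq> closure_chains n X c" for n
    by (rule subspace_chains_subset[OF B])
  have subA: "subspace_chains n c (A \<inter> B) \<subseteq> subspace_chains n c A" for n
    by (simp add: subspace_chains_Int[OF A B])
  have hom: "?f \<in> hom (rel_cycle_group n B ?d (A \<inter> B)) (rel_cycle_group n X c A)"
  proof (rule homI)
    fix K assume "K \<in> carrier (rel_cycle_group n B ?d (A \<inter> B))"
    then obtain a where a: "a \<in> subspace_chains n c B" "K = chain_coset n B ?d (A \<inter> B) a"
      "chain_boundary (nat n) a \<in> subspace_chains (n - 1) c (A \<inter> B)"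
      unfolding cycle_B unfolding d by blast
    have "?f K = chain_coset n X c A a" using a(1,2) f by simp
    then show "?f K \<in> carrier (rel_cycle_group n X c A)"
      unfolding mem_rel_cycle_group[OF A]
      using subsetD[OF sub a(1)] subsetD[OF subA a(3)] by blast
    fix L assume "L \<in> carrier (rel_cycle_group n B ?d (A \<inter> B))"
    then obtain b where b: "b \<in> subspace_chains n c B" "L = chain_coset n B ?d (A \<inter> B) b"
      unfolding cycle_B unfolding d by blast
    show "?f (K \<otimes>\<^bsub>rel_cycle_group n B ?d (A \<inter> B)\<^esub> L) = ?f K \<otimes>\<^bsub>rel_cycle_group n X c A\<^esub> ?f L"
      using a(1) b(1) sub add_closure_chains[OF a(1) b(1)]
      by (simp add: a(2) b(2) f chain_coset_mult[OF AB] chain_coset_mult[OF A] subset_iff)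
  qed
  show ?thesis
    unfolding rel_homology_map_def rel_homology_def
  proof (rule coset_map_iso[OF hom rel_boundaries_normal[OF AB] rel_boundaries_normal[OF A]])
    show "?f ` rel_boundaries n B ?d (A \<inter> B) \<subseteq> rel_boundaries n X c A"
    proof
      fix L assume "L \<in> ?f ` rel_boundaries n B ?d (A \<inter> B)"
      then obtain u where u: "u \<in> subspace_chains (n + 1) c B"
        "L = ?f (chain_coset n B ?d (A \<inter> B) (chain_boundary (nat (n + 1)) u))"
        by (auto simp: rel_boundaries_def carrier_rel_chain_group rel_chain_boundary_coset[OF AB])
      have "chain_boundary (nat (n + 1)) u \<in> subspace_chains n c B"
        using chain_boundary_closure_chains[OF u(1)] by simp
      then have "L = chain_coset n X c A (chain_boundary (nat (n + 1)) u)" using u(2) f by simp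
      then show "L \<in> rel_boundaries n X c A"
        using u(1) sub zero_closure_chains
        by (auto simp: chain_coset_rel_boundaries_iff[OF A] intro!: bexI[of _ u])
    qed
  next
    fix K assume "K \<in> carrier (rel_cycle_group n B ?d (A \<inter> B))" and K: "?f K \<in> rel_boundaries n X c A"
    then obtain b where b: "b \<in> subspace_chains n c B" "K = chain_coset n B ?d (A \<inter> B) b"
      "chain_boundary (nat n) b \<in> subspace_chains (n - 1) c (A \<inter> B)"
      unfolding cycle_B unfolding d by blast
    obtain u where "u \<in> closure_chains (n + 1) X c"
      "b - chain_boundary (nat (n + 1)) u \<in> subspace_chains n c A"
      using K unfolding b(2) f[OF b(1)] chain_coset_rel_boundaries_iff[OF A] by blast
    from relative_boundary_excised[OF cover b(1,3) this]
    show "K \<in> rel_boundaries n B ?d (A \<inter> B)" unfolding b(2) boundary_B unfolding d .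
  next
    fix L assume "L \<in> carrier (rel_cycle_group n X c A)"
    then obtain a where a: "a \<in> closure_chains n X c" "L = chain_coset n X c A a"
      "chain_boundary (nat n) a \<in> subspace_chains (n - 1) c A"
      unfolding mem_rel_cycle_group[OF A] by blast
    obtain b where b: "b \<in> subspace_chains n c B"
      "chain_boundary (nat n) b \<in> subspace_chains (n - 1) c (A \<inter> B)"
      and ab: "chain_coset n X c A (a - b) \<in> rel_boundaries n X c A"
      using relative_cycle_excised[OF cover a(1,3)] chain_coset_rel_boundaries_iff[OF A] by blast
    have "chain_coset n B ?d (A \<inter> B) b \<in> carrier (rel_cycle_group n B ?d (A \<inter> B))"
      unfolding cycle_B unfolding d using b by blast
    moreover have "L = chain_coset n X c A (a - b) \<otimes>\<^bsub>rel_cycle_group n X c A\<^esub>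
        ?f (chain_coset n B ?d (A \<inter> B) b)"
    proof -
      have bX: "b \<in> closure_chains n X c" using b(1) sub by blast
      show ?thesis
        using chain_coset_mult[OF A diff_closure_chains[OF a(1) bX] bX] a(2) f[OF b(1)] by simp
    qed
    then have "L \<in> rel_boundaries n X c A #>\<^bsub>rel_cycle_group n X c A\<^esub>
        ?f (chain_coset n B ?d (A \<inter> B) b)"
      using ab unfolding r_coset_def by blast
    ultimately show "\<exists>K\<in>carrier (rel_cycle_group n B ?d (A \<inter> B)).
        L \<in> rel_boundaries n X c A #>\<^bsub>rel_cycle_group n X c A\<^esub> ?f K"
      by blast
  qed
qed

text \<open>The interior of the complement of \<open>Z\<close> is the complement of the closure of \<open>Z\<close>, so the
  hypothesis on \<open>Z\<close> says that this interior and that of \<open>A\<close> leave no point uncovered.\<close>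

lemma (in closure_space) interior_cover_complement:
  assumes "Z \<subseteq> X" "A \<subseteq> X" "c Z \<subseteq> closure_interior X c A"
  shows "interior_cover X c {A, X - Z}"
  using assms closure_subset_carrier[of Z]
  by (auto simp: interior_cover_def closure_interior_def double_diff)

theorem theorem4p6:
  fixes X :: "'a set" and c :: "'a set \<Rightarrow> 'a set"
  assumes "closure_space X c"
  shows "(\<forall>A B. interior_cover X c {A, B} \<longrightarrow>
            (\<forall>n::int. rel_homology n X c A \<cong> rel_homology n B (subspace_closure c B) (A \<inter> B))) \<and>
         (\<forall>Z A. Z \<subseteq> A \<and> A \<subseteq> X \<and> c Z \<subseteq> closure_interior X c A \<longrightarrow>
            (\<forall>n::int. rel_homology_map n X c A (\<lambda>x. x)
               \<in> iso (rel_homology n (X - Z) (subspace_closure c (X - Z)) (A - Z))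
                     (rel_homology n X c A)))"
proof (intro conjI allI impI)
  interpret closure_space X c by fact
  {
    fix A B and n :: int assume cover: "interior_cover X c {A, B}"
    have "group (rel_homology n B (subspace_closure c B) (A \<inter> B))"
      by (rule group_rel_homology) simp
    moreover have "rel_homology n B (subspace_closure c B) (A \<inter> B) \<cong> rel_homology n X c A"
      using excision_iso[OF cover] by (auto simp: is_iso_def)
    ultimately show "rel_homology n X c A \<cong> rel_homology n B (subspace_closure c B) (A \<inter> B)"
      by (rule group.iso_sym)
  }
  fix Z A and n :: int assume "Z \<subseteq> A \<and> A \<subseteq> X \<and> c Z \<subseteq> closure_interior X c A"
  then have ZA: "Z \<subseteq> X" "A \<subseteq> X" "c Z \<subseteq> closure_interior X c A" by auto
  then have "A \<inter> (X - Z) = A - Z" by blast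
  then show "rel_homology_map n X c A (\<lambda>x. x)
      \<in> iso (rel_homology n (X - Z) (subspace_closure c (X - Z)) (A - Z)) (rel_homology n X c A)"
    using excision_iso[OF interior_cover_complement[OF ZA], of n] by simp
qed

end
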